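(* For any $3$-dimensional 0-1 matrix $P$ in $$ \left\{ \left( \begin{pmatrix} 1 & 0 \\ 1 & 0 \end{pmatrix}; \begin{pmatrix} 0 & 1 \\ 0 & 1 \end{pmatrix} \right), \left( \begin{pmatrix} 1 & 0 \\ 1 & 0 \end{pmatrix}; \begin{pmatrix} 0 & 1 \\ 0 & 0 \end{pmatrix}; \begin{pmatrix} 0 & 0 \\ 0 & 1 \end{pmatrix} \right) \right\}, $$ we have $\operatorname{ex}(n,P,3)=\Theta(n^{2.5})$ and $P$ is minimally non-$O(n^2)$.
   Context: A $3$-dimensional matrix $A$ of dimensions $a\times b\times c$ is written as the list of its layers with first coordinate $1,2,\dots,a$ (separated by semicolons), each being a $b\times c$ matrix whose entry in row $y$, column $z$ of the $x$-th layer is $A(x,y,z)$. Thus the first matrix is $2\times2\times2$ with $1$-entries exactly at $(1,1,1),(1,2,1),(2,1,2),(2,2,2)$, and the second is $3\times2\times2$ with $1$-entries exactly at $(1,1,1),(1,2,1),(2,1,2),(3,2,2)$. A $d$-dimensional 0-1 matrix $A$ contains a $d$-dimensional 0-1 matrix $P$ if $A$ has a submatrix (obtained by restricting each of the $d$ coordinates to a subset of its range) of the same dimensions as $P$ that can be turned into $P$ by changing any number of $1$-entries to $0$-entries; otherwise $A$ is $P$-free. $P'$ is properly contained in $P$ if $P$ contains $P'$ and $P'\neq P$. $\operatorname{ex}(n,P,d)$ is the maximum possible number of $1$-entries in a $P$-free $d$-dimensional $n\times\dots\times n$ 0-1 matrix (taken to be $0$ if no such matrix exists). A $3$-dimensional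 0-1 matrix $P$ is minimally non-$O(n^2)$ if $\operatorname{ex}(n,P,3)=\omega(n^2)$ but $\operatorname{ex}(n,P',3)=O(n^2)$ for every $3$-dimensional 0-1 matrix $P'$ properly contained in $P$. Asymptotics are for $n\to\infty$. *)

theory Defs
  imports Complex_Main "HOL-Library.Landau_Symbols"
begin

text \<open>
  A three-dimensional 0-1 matrix is given by its dimensions \<open>(a, b, c)\<close> and the set of positions
  of its 1-entries; coordinates start at 1. Under \<open>is_mat3\<close>, equality of records is equality of
  matrices (same dimensions, same entries).
\<close>

record mat3 =
  dims :: "nat \<times> nat \<times> nat"
  ones :: "(nat \<times> nat \<times> nat) set"

fun box3 :: "nat \<times> nat \<times> nat \<Rightarrow> (nat \<times> nat \<times> nat) set" where
  "box3 (a, b, c) = {1..a} \<times> {1..b} \<times> {1..c}"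

fun pos_dims :: "nat \<times> nat \<times> nat \<Rightarrow> bool" where
  "pos_dims (a, b, c) \<longleftrightarrow> 1 \<le> a \<and> 1 \<le> b \<and> 1 \<le> c"

definition is_mat3 :: "mat3 \<Rightarrow> bool" where
  "is_mat3 A \<longleftrightarrow> pos_dims (dims A) \<and> ones A \<subseteq> box3 (dims A)"

text \<open>
  The matrix whose \<open>x\<close>-th layer is the \<open>x\<close>-th list, each layer being a list of rows. The dimensions
  are read off the first layer and its first row.
\<close>

definition of_layers :: "nat list list list \<Rightarrow> mat3" where
  "of_layers L =
     (let d = (length L, length (L ! 0), length (L ! 0 ! 0))
      in \<lparr>dims = d, ones = {(x, y, z) \<in> box3 d. L ! (x - 1) ! (y - 1) ! (z - 1) = 1}\<rparr>)"

lemma of_layers_222: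
  "of_layers [[[1, 0], [1, 0]], [[0, 1], [0, 1]]] =
     \<lparr>dims = (2, 2, 2), ones = {(1, 1, 1), (1, 2, 1), (2, 1, 2), (2, 2, 2)}\<rparr>"
  by (auto simp: of_layers_def Let_def numeral_eq_Suc le_Suc_eq)

lemma of_layers_322:
  "of_layers [[[1, 0], [1, 0]], [[0, 1], [0, 0]], [[0, 0], [0, 1]]] =
     \<lparr>dims = (3, 2, 2), ones = {(1, 1, 1), (1, 2, 1), (2, 1, 2), (3, 2, 2)}\<rparr>"
  by (auto simp: of_layers_def Let_def numeral_eq_Suc le_Suc_eq)

text \<open>The \<open>i\<close>-th smallest element of a finite set, for \<open>1 \<le> i \<le> card X\<close>.\<close>

definition nth_elem :: "nat set \<Rightarrow> nat \<Rightarrow> nat" where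
  "nth_elem X i = sorted_list_of_set X ! (i - 1)"

text \<open>
  Restriction of the three coordinates to \<open>X\<close>, \<open>Y\<close>, \<open>Z\<close>, with the remaining coordinates renumbered
  in increasing order.
\<close>

definition submatrix3 :: "mat3 \<Rightarrow> nat set \<Rightarrow> nat set \<Rightarrow> nat set \<Rightarrow> mat3" where
  "submatrix3 A X Y Z =
     \<lparr>dims = (card X, card Y, card Z),
      ones = {(i, j, k) \<in> box3 (card X, card Y, card Z).
                (nth_elem X i, nth_elem Y j, nth_elem Z k) \<in> ones A}\<rparr>"

definition contains :: "mat3 \<Rightarrow> mat3 \<Rightarrow> bool" where
  "contains A P \<longleftrightarrow>
     (\<exists>X Y Z. X \<subseteq> {1..fst (dims A)} \<and>
        Y \<subseteq> {1..fst (snd (dims A))} \<and>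
        Z \<subseteq> {1..snd (snd (dims A))} \<and>
        dims (submatrix3 A X Y Z) = dims P \<and> ones P \<subseteq> ones (submatrix3 A X Y Z))"

definition properly_contained :: "mat3 \<Rightarrow> mat3 \<Rightarrow> bool" where
  "properly_contained P' P \<longleftrightarrow> contains P P' \<and> P' \<noteq> P"

definition free_weights :: "nat \<Rightarrow> mat3 \<Rightarrow> nat set" where
  "free_weights n P =
     {card (ones A) | A. is_mat3 A \<and> dims A = (n, n, n) \<and> \<not> contains A P}"

definition ex3 :: "nat \<Rightarrow> mat3 \<Rightarrow> nat" where
  "ex3 n P = (if free_weights n P = {} then 0 else Max (free_weights n P))"

definition minimally_non_O_n2 :: "mat3 \<Rightarrow> bool" where
  "minimally_non_O_n2 P \<longleftrightarrow>
     is_mat3 P \<and>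
     (\<lambda>n. real (ex3 n P)) \<in> \<omega>(\<lambda>n. real n ^ 2) \<and>
     (\<forall>P'. is_mat3 P' \<and> properly_contained P' P \<longrightarrow>
        (\<lambda>n. real (ex3 n P')) \<in> O(\<lambda>n. real n ^ 2))"

end

theory Submission
  imports
    Defs
    "HOL-Library.Z2"
    "HOL-Algebra.Algebraic_Closure_Type"
    "HOL-Analysis.Convex"
    "HOL-Real_Asymp.Real_Asymp"
begin

text \<open>
  Lower bound: projecting either pattern along the first coordinate gives the full \<open>2 \<times> 2\<close> pattern, so
  \<open>n\<close> equal copies of an \<open>n \<times> n\<close> matrix with at least \<open>n powr 1.5 / 8\<close> 1-entries and no rectangle (points
  and lines of an affine plane) avoid it.

  Upper bound for the \<open>2 \<times> 2 \<times> 2\<close> pattern: the diagonals \<open>x - z = const\<close> are chains in the \<open>(x, z)\<close>-plane,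
  so on each diagonal a pair \<open>{y, y'}\<close> occurs above at most one point. Hence there are \<open>O(n\<^sup>3)\<close>
  triples \<open>((x, z), y, y')\<close>, and the Cauchy-Schwarz inequality bounds the number of 1-entries. A matrix
  avoiding the \<open>3 \<times> 2 \<times> 2\<close> pattern avoids the \<open>2 \<times> 2 \<times> 2\<close> one after the last 1-entry of each line in
  direction \<open>x\<close> is deleted.

  Minimality: a matrix properly contained in the pattern is contained in it with one 1-entry removed.
  The three remaining entries of the \<open>2 \<times> 2 \<times> 2\<close> pattern consist of a pivot, a point on its \<open>y\<close>-line
  and a point on its diagonal, and all but \<open>O(n\<^sup>2)\<close> 1-entries can serve as pivot; deleting last
  1-entries in direction \<open>x\<close> transfers this to the \<open>3 \<times> 2 \<times> 2\<close> pattern.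
\<close>

section \<open>Rectangle-free matrices\<close>

lemma CHAR_bit: "CHAR(bit) = 2"
proof (rule CHAR_eqI)
  show "of_nat 2 = (0::bit)" by simp
  show "2 dvd n" if "of_nat n = (0::bit)" for n
    using that by (metis bit_not_zero_iff even_of_nat_iff even_zero)
qed

text \<open>The roots of the separable polynomial \<open>X ^ q - X\<close> with \<open>q = 2 ^ k\<close>; for \<open>k = 0\<close> it is zero, whence
  the separate case.\<close>

lemma finite_subring_alg_closure_bit:
  obtains F :: "bit alg_closure set"
  where "finite F" "card F = 2 ^ k" "\<And>x y. x \<in> F \<Longrightarrow> y \<in> F \<Longrightarrow> x + y \<in> F"
    "\<And>x y. x \<in> F \<Longrightarrow> y \<in> F \<Longrightarrow> x * y \<in> F"
proof (cases "k = 0")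
  case True
  then show ?thesis using that[of "{0}"] by simp
next
  case False
  define q :: nat where "q = 2 ^ k"
  define p :: "bit alg_closure poly" where "p = monom 1 q - monom 1 1"
  have q: "q > 1" unfolding q_def using False by (intro one_less_power) auto
  have char: "CHAR(bit alg_closure) = 2" by (simp add: CHAR_bit)
  have "2 dvd q" using False by (simp add: q_def)
  then have q0: "of_nat q = (0 :: bit alg_closure)"
    by (subst of_nat_eq_0_iff_char_dvd) (simp only: char)
  have deg: "degree p = q"
    unfolding p_def diff_conv_add_uminus using q by (subst degree_add_eq_left) (auto simp: degree_monom_eq)
  have "p \<noteq> 0" using deg q by auto
  have lc: "lead_coeff p = 1"
    unfolding deg using q by (simp add: p_def)
  obtain R where R: "size R = q" "p = (\<Prod>x\<in>#R. [:-x, 1:])"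
    using alg_closed_imp_factorization[OF \<open>p \<noteq> 0\<close>] lc deg by auto
  have pd: "pderiv p = - 1"
    by (simp add: p_def pderiv_diff pderiv_monom q0 monom_0 one_pCons)
  \<comment> \<open>A multiple root of \<open>p\<close> would also be a root of its derivative,
    which is the constant -1 because \<open>q\<close> vanishes in characteristic 2.\<close>
  have simple: "count R a \<le> 1" for a
  proof (rule ccontr)
    assume "\<not> count R a \<le> 1"
    then have "{#a, a#} \<subseteq># R" by (auto simp: subseteq_mset_def)
    then obtain R' where "R = {#a, a#} + R'" by (auto simp: subset_mset.le_iff_add)
    then have "p = [:-a, 1:] * ([:-a, 1:] * (\<Prod>x\<in>#R'. [:-x, 1:]))" using R by simp
    moreover define L where "L = [:-a, 1:]"
    moreover have "poly L a = 0" by (simp add: L_def)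
    ultimately have "poly (pderiv p) a = 0" by (simp only: pderiv_mult poly_add poly_mult) simp
    then show False by (simp add: pd)
  qed
  have "R = mset_set (set_mset R)"
  proof (rule multiset_eqI)
    fix a
    show "count R a = count (mset_set (set_mset R)) a"
      using simple[of a] by (cases "a \<in># R") (auto simp: count_eq_zero_iff le_Suc_eq)
  qed
  then have card: "card (set_mset R) = q"
    using R(1) by (metis size_mset_set)
  have mem: "x \<in># R \<longleftrightarrow> x ^ q = x" for x
  proof -
    have "x \<in># R \<longleftrightarrow> poly p x = 0"
      by (auto simp: R(2) poly_prod_mset prod_mset_zero_iff)
    also have "\<dots> \<longleftrightarrow> x ^ q = x" by (simp add: p_def poly_monom)
    finally show ?thesis .
  qed
  show ?thesis
  proof (rule that[of "set_mset R"])
    show "card (set_mset R) = 2 ^ k" using card q_def by simp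
    \<comment> \<open>Since \<open>q\<close> is a power of the characteristic, the
      \<open>q\<close>-th power map is additive, so its fixed points are closed under
      addition.\<close>
    have "(x + y) ^ q = x ^ q + y ^ q" for x y :: "bit alg_closure"
      by (rule freshmans_dream'[where n = k]) (simp_all only: char q_def two_is_prime_nat)
    then show "x + y \<in># R" if "x \<in># R" "y \<in># R" for x y
      using that by (simp add: mem)
    show "x * y \<in># R" if "x \<in># R" "y \<in># R" for x y
      using that by (simp add: mem power_mult_distrib)
  qed simp
qed

definition rectangle_free :: "('a \<times> 'b) set \<Rightarrow> bool" where
  "rectangle_free B \<longleftrightarrow> (\<forall>y1 y2 z1 z2. {(y1, z1), (y2, z1), (y1, z2), (y2, z2)} \<subseteq> B \<longrightarrow> y1 = y2 \<or> z1 = z2)"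

text \<open>Subtracting the equations gives \<open>(m - m') * (a - a') = 0\<close>, and an integral
  domain has no zero divisors.\<close>

lemma lines_meet_once:
  fixes a :: "'a :: idom"
  assumes "b = m * a + c" "b = m' * a + c'" "b' = m * a' + c" "b' = m' * a' + c'"
  shows "(a = a' \<and> b = b') \<or> (m = m' \<and> c = c')"
proof -
  have "(m - m') * (a - a') = ((m * a + c) - (m' * a + c')) - ((m * a' + c) - (m' * a' + c'))"
    by (simp add: algebra_simps)
  also have "\<dots> = 0" unfolding assms[symmetric] by simp
  finally have "m = m' \<or> a = a'" by simp
  then show ?thesis
  proof
    assume "m = m'"
    then show ?thesis using assms(1,2) by simp
  next
    assume "a = a'"
    then show ?thesis using assms(1,3) by simp
  qed
qed

text \<open>The point-line incidences of the affine plane over the field with \<open>q = 2 ^ k\<close> elements,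
  without the vertical lines.\<close>

lemma rectangle_free_power_of_2:
  obtains B :: "(nat \<times> nat) set"
  where "B \<subseteq> {1..(2 ^ k)^2} \<times> {1..(2 ^ k)^2}" "rectangle_free B" "card B = (2 ^ k)^3"
proof -
  define q :: nat where "q = 2 ^ k"
  obtain F :: "bit alg_closure set"
    where F: "finite F" "card F = q"
      and add: "\<And>x y. x \<in> F \<Longrightarrow> y \<in> F \<Longrightarrow> x + y \<in> F"
      and mult: "\<And>x y. x \<in> F \<Longrightarrow> y \<in> F \<Longrightarrow> x * y \<in> F"
    using finite_subring_alg_closure_bit[of k] unfolding q_def by blast
  have "card (F \<times> F) = card {1..q^2}" by (simp add: F(2) card_cartesian_product power2_eq_square)
  then obtain \<phi> where \<phi>: "bij_betw \<phi> (F \<times> F) {1..q^2}"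
    using finite_same_card_bij[of "F \<times> F" "{1..q^2}"] F(1) by auto
  then have inj: "\<phi> u = \<phi> v \<longleftrightarrow> u = v" if "u \<in> F \<times> F" "v \<in> F \<times> F" for u v
    using that by (auto simp: bij_betw_def inj_on_def)
  have im: "\<phi> u \<in> {1..q^2}" if "u \<in> F \<times> F" for u using \<phi> that by (auto simp: bij_betw_def)
  \<comment> \<open>The triple \<open>(a, m, c)\<close> encodes the incidence of the line with slope
    \<open>m\<close> and intercept \<open>c\<close> with its point above \<open>a\<close>. The same
    numbering \<open>\<phi>\<close> serves points and lines.\<close>
  define e where "e = (\<lambda>(a, m, c). (\<phi> (a, m * a + c), \<phi> (m, c)))"
  define B where "B = e ` (F \<times> F \<times> F)"
  show ?thesis
  proof (rule that[of B])
    show "B \<subseteq> {1..(2 ^ k)^2} \<times> {1..(2 ^ k)^2}"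
      unfolding B_def q_def[symmetric] using im by (auto simp: e_def add mult simp del: atLeastAtMost_iff One_nat_def)
    have "inj_on e (F \<times> F \<times> F)"
      by (rule inj_onI) (auto simp: e_def inj add mult)
    then show "card B = (2 ^ k)^3"
      unfolding B_def q_def[symmetric]
      by (simp add: card_image card_cartesian_product F(2) power3_eq_cube)
    have mem: "(\<phi> u, \<phi> v) \<in> B \<longleftrightarrow> snd u = fst v * fst u + snd v" if "u \<in> F \<times> F" "v \<in> F \<times> F" for u v
      using that unfolding B_def e_def
      by (cases u; cases v) (force simp: inj add mult image_iff)
    show "rectangle_free B"
      unfolding rectangle_free_def
    proof (intro allI impI)
      fix y1 y2 z1 z2
      assume sub: "{(y1, z1), (y2, z1), (y1, z2), (y2, z2)} \<subseteq> B"
      have "B \<subseteq> \<phi> ` (F \<times> F) \<times> \<phi> ` (F \<times> F)"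
        unfolding B_def e_def by (auto simp: add mult intro!: imageI)
      with sub have "y1 \<in> \<phi> ` (F \<times> F)" "y2 \<in> \<phi> ` (F \<times> F)" "z1 \<in> \<phi> ` (F \<times> F)" "z2 \<in> \<phi> ` (F \<times> F)"
        by blast+
      then obtain u1 u2 v1 v2 where uv: "u1 \<in> F \<times> F" "u2 \<in> F \<times> F" "v1 \<in> F \<times> F" "v2 \<in> F \<times> F"
        "y1 = \<phi> u1" "y2 = \<phi> u2" "z1 = \<phi> v1" "z2 = \<phi> v2" by (elim imageE)
      with sub have eqs: "snd u1 = fst v1 * fst u1 + snd v1" "snd u2 = fst v1 * fst u2 + snd v1"
        "snd u1 = fst v2 * fst u1 + snd v2" "snd u2 = fst v2 * fst u2 + snd v2"
        by (simp_all flip: mem)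
      then have "u1 = u2 \<or> v1 = v2"
        using lines_meet_once[OF eqs(1,3,2,4)] by (simp only: prod_eq_iff)
      then show "y1 = y2 \<or> z1 = z2" using uv by auto
    qed
  qed
qed

lemma rectangle_free_large:
  assumes "n \<ge> 1"
  obtains B :: "(nat \<times> nat) set"
  where "B \<subseteq> {1..n} \<times> {1..n}" "rectangle_free B" "real n powr (3/2) \<le> 8 * real (card B)"
proof -
  \<comment> \<open>The plane over the field of order \<open>2 ^ k\<close> has \<open>4 ^ k\<close>
    points and as many non-vertical lines. Since \<open>n < 4 * 4 ^ k\<close>, rounding down to this
    size costs at most the factor \<open>4 powr (3/2) = 8\<close>.\<close>
  obtain k where k: "4 ^ k \<le> n" "n < 4 ^ (k + 1)"
    using ex_power_ivl1[of 4 n] assms by auto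
  obtain B :: "(nat \<times> nat) set"
    where B: "B \<subseteq> {1..(2 ^ k)^2} \<times> {1..(2 ^ k)^2}" "rectangle_free B" "card B = (2 ^ k)^3"
    by (rule rectangle_free_power_of_2)
  have p: "(2 ^ k)^2 = (4::nat) ^ k" "(2 ^ k)^2 = (4::real) ^ k"
    by (simp_all add: power2_eq_square flip: power_mult_distrib)
  have "B \<subseteq> {1..n} \<times> {1..n}" using B(1) k(1) unfolding p(1) by fastforce
  moreover have "real n powr (3/2) \<le> 8 * real (card B)"
  proof -
    have "real n \<le> 4 ^ (k + 1)" using k(2) by (metis less_imp_le of_nat_le_iff of_nat_numeral of_nat_power)
    also have "\<dots> = (2 * 2 ^ k)^2" by (simp add: power_mult_distrib p)
    finally have "real n powr (3/2) \<le> ((2 * 2 ^ k)^2) powr (3/2)" by (intro powr_mono2) auto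
    also have "\<dots> = (2 * 2 ^ k) ^ 3"
    proof -
      have *: "r\<^sup>2 powr (3/2) = r ^ 3" if "r > 0" for r :: real
        using that by (simp add: powr_powr flip: powr_numeral)
      show ?thesis by (rule *) simp
    qed
    finally show ?thesis by (simp add: B(3) power_mult_distrib)
  qed
  ultimately show ?thesis using that B(2) by blast
qed

section \<open>Containment and extremal numbers\<close>

lemma strict_mono_on_nth_elem:
  assumes "finite U"
  shows "strict_mono_on {1..card U} (nth_elem U)"
  unfolding strict_mono_on_def nth_elem_def
  using assms by (auto intro!: sorted_wrt_nth_less[of "(<)"])

lemma nth_elem_in:
  assumes "finite U" "i \<in> {1..card U}"
  shows "nth_elem U i \<in> U"
  using assms nth_mem[of "i - 1" "sorted_list_of_set U"] by (auto simp: nth_elem_def)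

lemma nth_elem_image:
  assumes f: "strict_mono_on {1..a} f" and i: "i \<in> {1..a}"
  shows "nth_elem (f ` {1..a}) i = f i"
proof -
  have "sorted_list_of_set (f ` {1..a}) = map f [1..<Suc a]"
  proof (rule sorted_list_of_set.idem_if_sorted_distinct[of "map f [1..<Suc a]", simplified set_map set_upt atLeastLessThanSuc_atLeastAtMost])
    have "sorted_wrt (<) (map f [1..<Suc a])"
      unfolding sorted_wrt_map
      by (rule sorted_wrt_mono_rel[OF _ sorted_wrt_upt]) (auto intro: strict_mono_onD[OF f])
    then show "sorted (map f [1..<Suc a])" "distinct (map f [1..<Suc a])"
      by (simp_all add: strict_sorted_iff)
  qed
  moreover have "[1..<Suc a] ! (i - 1) = i" using i by (subst nth_upt) auto
  moreover have "map f [1..<Suc a] ! (i - 1) = f ([1..<Suc a] ! (i - 1))"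
    using i by (intro nth_map) auto
  ultimately show ?thesis by (simp add: nth_elem_def del: upt_Suc One_nat_def)
qed

lemma card_strict_mono_image:
  assumes "strict_mono_on {1..a::nat} (f :: nat \<Rightarrow> nat)"
  shows "card (f ` {1..a}) = a"
  using assms by (simp add: card_image strict_mono_on_imp_inj_on)

text \<open>Trades index sets for strictly increasing index maps: \<open>nth_elem U\<close>
  enumerates a set, and the image of a map gives the set back. Such maps can be composed and written
  down explicitly.\<close>

lemma contains_iff:
  assumes A: "dims A = (a, b, c)" and P: "dims P = (a', b', c')" "ones P \<subseteq> box3 (dims P)"
  shows "contains A P \<longleftrightarrow> (\<exists>f g h.
    strict_mono_on {1..a'} f \<and> strict_mono_on {1..b'} g \<and> strict_mono_on {1..c'} h \<and>
    f ` {1..a'} \<subseteq> {1..a} \<and> g ` {1..b'} \<subseteq> {1..b} \<and> h ` {1..c'} \<subseteq> {1..c} \<and>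
    (\<forall>(x, y, z) \<in> ones P. (f x, g y, h z) \<in> ones A))" (is "_ \<longleftrightarrow> ?R")
proof
  assume "contains A P"
  then obtain U V W where UVW: "U \<subseteq> {1..a}" "V \<subseteq> {1..b}" "W \<subseteq> {1..c}"
    "card U = a'" "card V = b'" "card W = c'" "ones P \<subseteq> ones (submatrix3 A U V W)"
    unfolding contains_def by (auto simp: A P(1) submatrix3_def)
  then have fin: "finite U" "finite V" "finite W" by (auto intro: finite_subset)
  show ?R
  proof (intro exI conjI)
    show "strict_mono_on {1..a'} (nth_elem U)" "strict_mono_on {1..b'} (nth_elem V)"
      "strict_mono_on {1..c'} (nth_elem W)"
      using strict_mono_on_nth_elem[OF fin(1)] strict_mono_on_nth_elem[OF fin(2)]
        strict_mono_on_nth_elem[OF fin(3)] UVW by simp_all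
    show "nth_elem U ` {1..a'} \<subseteq> {1..a}" "nth_elem V ` {1..b'} \<subseteq> {1..b}"
      "nth_elem W ` {1..c'} \<subseteq> {1..c}"
      using nth_elem_in[OF fin(1)] nth_elem_in[OF fin(2)] nth_elem_in[OF fin(3)] UVW by blast+
    show "\<forall>(x, y, z) \<in> ones P. (nth_elem U x, nth_elem V y, nth_elem W z) \<in> ones A"
      using UVW(7) by (auto simp: submatrix3_def)
  qed
next
  assume ?R
  then obtain f g h where m: "strict_mono_on {1..a'} f" "strict_mono_on {1..b'} g" "strict_mono_on {1..c'} h"
    and im: "f ` {1..a'} \<subseteq> {1..a}" "g ` {1..b'} \<subseteq> {1..b}" "h ` {1..c'} \<subseteq> {1..c}"
    and sub: "\<forall>(x, y, z) \<in> ones P. (f x, g y, h z) \<in> ones A" by (elim exE conjE) (rule that)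
  show "contains A P"
    unfolding contains_def
  proof (intro exI conjI)
    show "f ` {1..a'} \<subseteq> {1..fst (dims A)}" "g ` {1..b'} \<subseteq> {1..fst (snd (dims A))}"
      "h ` {1..c'} \<subseteq> {1..snd (snd (dims A))}" using im by (simp_all add: A)
    show "dims (submatrix3 A (f ` {1..a'}) (g ` {1..b'}) (h ` {1..c'})) = dims P"
      by (simp add: submatrix3_def m[THEN card_strict_mono_image] P(1) del: One_nat_def)
    show "ones P \<subseteq> ones (submatrix3 A (f ` {1..a'}) (g ` {1..b'}) (h ` {1..c'}))"
    proof
      fix p assume p: "p \<in> ones P"
      obtain x y z where xyz: "p = (x, y, z)" by (cases p)
      then have box: "x \<in> {1..a'}" "y \<in> {1..b'}" "z \<in> {1..c'}" using p P by auto
      have "(f x, g y, h z) \<in> ones A" using sub p xyz by blast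
      then show "p \<in> ones (submatrix3 A (f ` {1..a'}) (g ` {1..b'}) (h ` {1..c'}))"
        using box unfolding xyz
        by (simp add: submatrix3_def m[THEN card_strict_mono_image] m[THEN nth_elem_image]
            del: atLeastAtMost_iff One_nat_def)
    qed
  qed
qed

lemma submatrix3_full:
  assumes "is_mat3 P" "dims P = (a, b, c)"
  shows "submatrix3 P {1..a} {1..b} {1..c} = P"
proof -
  have id: "nth_elem {1..k} i = i" if "1 \<le> i" "i \<le> k" for i k
    using nth_elem_image[of k id i] that by (simp add: strict_mono_on_def)
  show ?thesis
    using assms by (cases P) (auto simp: submatrix3_def is_mat3_def id[unfolded One_nat_def])
qed

lemma contains_trans:
  assumes "contains A P" "contains P Q" "ones P \<subseteq> box3 (dims P)" "ones Q \<subseteq> box3 (dims Q)"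
  shows "contains A Q"
proof -
  obtain a b c where A: "dims A = (a, b, c)" by (cases "dims A")
  obtain a' b' c' where P: "dims P = (a', b', c')" by (cases "dims P")
  obtain a'' b'' c'' where Q: "dims Q = (a'', b'', c'')" by (cases "dims Q")
  obtain f g h where f: "strict_mono_on {1..a'} f" "strict_mono_on {1..b'} g" "strict_mono_on {1..c'} h"
    "f ` {1..a'} \<subseteq> {1..a}" "g ` {1..b'} \<subseteq> {1..b}" "h ` {1..c'} \<subseteq> {1..c}"
    "\<forall>(x, y, z) \<in> ones P. (f x, g y, h z) \<in> ones A"
    using assms(1) unfolding contains_iff[OF A P assms(3)] by (elim exE conjE) (rule that)
  obtain f' g' h' where g: "strict_mono_on {1..a''} f'" "strict_mono_on {1..b''} g'" "strict_mono_on {1..c''} h'"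
    "f' ` {1..a''} \<subseteq> {1..a'}" "g' ` {1..b''} \<subseteq> {1..b'}" "h' ` {1..c''} \<subseteq> {1..c'}"
    "\<forall>(x, y, z) \<in> ones Q. (f' x, g' y, h' z) \<in> ones P"
    using assms(2) unfolding contains_iff[OF P Q assms(4)] by (elim exE conjE) (rule that)
  have comp: "strict_mono_on S (u \<circ> v)" if "strict_mono_on T u" "strict_mono_on S v" "v ` S \<subseteq> T"
    for u v :: "nat \<Rightarrow> nat" and S T
    using that unfolding strict_mono_on_def by (auto simp: image_subset_iff)
  show ?thesis
    unfolding contains_iff[OF A Q assms(4)]
  proof (intro exI conjI)
    show "strict_mono_on {1..a''} (f \<circ> f')" "strict_mono_on {1..b''} (g \<circ> g')" "strict_mono_on {1..c''} (h \<circ> h')"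
      by (rule comp[OF f(1) g(1) g(4)], rule comp[OF f(2) g(2) g(5)], rule comp[OF f(3) g(3) g(6)])
    show "(f \<circ> f') ` {1..a''} \<subseteq> {1..a}" "(g \<circ> g') ` {1..b''} \<subseteq> {1..b}" "(h \<circ> h') ` {1..c''} \<subseteq> {1..c}"
      unfolding image_comp[symmetric]
      by (rule order.trans[OF image_mono[OF g(4)] f(4)], rule order.trans[OF image_mono[OF g(5)] f(5)],
          rule order.trans[OF image_mono[OF g(6)] f(6)])
    show "\<forall>(x, y, z) \<in> ones Q. ((f \<circ> f') x, (g \<circ> g') y, (h \<circ> h') z) \<in> ones A"
    proof clarify
      fix x y z assume "(x, y, z) \<in> ones Q"
      with g(7) have "(f' x, g' y, h' z) \<in> ones P" by blast
      with f(7) show "((f \<circ> f') x, (g \<circ> g') y, (h \<circ> h') z) \<in> ones A" by auto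
    qed
  qed
qed

text \<open>If every 1-entry of \<open>P\<close> came from one of \<open>P'\<close>, all three index
  sets would be full, because each layer in each direction has a 1-entry, and \<open>P'\<close>
  would equal \<open>P\<close>. So some 1-entry is missed and can be deleted. Minimality thus
  reduces to the patterns with a single 1-entry removed.\<close>

lemma contains_remove_entry:
  assumes P: "is_mat3 P" "dims P = (a, b, c)"
    and layers: "fst ` ones P = {1..a}" "(fst \<circ> snd) ` ones P = {1..b}" "(snd \<circ> snd) ` ones P = {1..c}"
    and P': "is_mat3 P'" "properly_contained P' P"
  obtains e where "e \<in> ones P" "contains (P\<lparr>ones := ones P - {e}\<rparr>) P'"
proof -
  obtain U V W where UVW: "U \<subseteq> {1..a}" "V \<subseteq> {1..b}" "W \<subseteq> {1..c}"
    and d: "dims (submatrix3 P U V W) = dims P'" and sub: "ones P' \<subseteq> ones (submatrix3 P U V W)"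
    using P'(2) unfolding properly_contained_def contains_def by (auto simp: P(2))
  then have fin: "finite U" "finite V" "finite W" by (auto intro: finite_subset)
  define \<iota> where "\<iota> = (\<lambda>(i, j, k). (nth_elem U i, nth_elem V j, nth_elem W k))"
  have "\<exists>e \<in> ones P. e \<notin> \<iota> ` ones P'"
  proof (rule ccontr)
    assume "\<not> ?thesis"
    then have hit: "ones P \<subseteq> \<iota> ` ones P'" by blast
    have "ones P' \<subseteq> box3 (card U, card V, card W)" using sub by (auto simp: submatrix3_def)
    then have "\<iota> ` ones P' \<subseteq> U \<times> V \<times> W"
      unfolding \<iota>_def by (auto simp del: atLeastAtMost_iff One_nat_def intro!: fin[THEN nth_elem_in])
    with hit have "ones P \<subseteq> U \<times> V \<times> W" by blast
    then have "{1..a} \<subseteq> U" "{1..b} \<subseteq> V" "{1..c} \<subseteq> W"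
      unfolding layers[symmetric] by auto
    with UVW have eq: "U = {1..a}" "V = {1..b}" "W = {1..c}" by auto
    then have sm: "submatrix3 P U V W = P" using submatrix3_full[OF P] by simp
    have "finite (ones P')"
      using P'(1) by (cases "dims P'") (auto simp: is_mat3_def intro: finite_subset)
    then have "card (ones P) \<le> card (ones P')" using hit by (rule surj_card_le)
    moreover have "finite (ones P)" using P by (auto simp: is_mat3_def intro: finite_subset)
    \<comment> \<open>The submatrix is now \<open>P\<close> itself, so \<open>ones P'\<close> is a
      subset of \<open>ones P\<close> with at least as many elements.\<close>
    ultimately have "ones P' = ones P" using sub sm by (metis card_seteq)
    then have "P' = P" using d sm by simp
    then show False using P'(2) by (simp add: properly_contained_def)
  qed
  then obtain e where e: "e \<in> ones P" "e \<notin> \<iota> ` ones P'" by blast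
  have "contains (P\<lparr>ones := ones P - {e}\<rparr>) P'"
    unfolding contains_def
  proof (intro exI conjI)
    show "U \<subseteq> {1..fst (dims (P\<lparr>ones := ones P - {e}\<rparr>))}"
      "V \<subseteq> {1..fst (snd (dims (P\<lparr>ones := ones P - {e}\<rparr>)))}"
      "W \<subseteq> {1..snd (snd (dims (P\<lparr>ones := ones P - {e}\<rparr>)))}" using UVW by (simp_all add: P)
    show "dims (submatrix3 (P\<lparr>ones := ones P - {e}\<rparr>) U V W) = dims P'" using d by (simp add: submatrix3_def)
    show "ones P' \<subseteq> ones (submatrix3 (P\<lparr>ones := ones P - {e}\<rparr>) U V W)"
    proof
      fix p assume p: "p \<in> ones P'"
      then have "p \<in> ones (submatrix3 P U V W)" "\<iota> p \<noteq> e" using sub e(2) by auto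
      then show "p \<in> ones (submatrix3 (P\<lparr>ones := ones P - {e}\<rparr>) U V W)"
        by (cases p) (simp add: submatrix3_def \<iota>_def)
    qed
  qed
  with e(1) show ?thesis by (rule that)
qed

section \<open>Bounding extremal numbers from below and above\<close>

lemma card_le_ex3:
  assumes "is_mat3 A" "dims A = (n, n, n)" "\<not> contains A P"
  shows "card (ones A) \<le> ex3 n P"
proof -
  \<comment> \<open>Boundedness makes the set finite, so \<open>Max\<close> is a genuine
    maximum.\<close>
  have "free_weights n P \<subseteq> {..card (box3 (n, n, n))}"
    by (auto simp: free_weights_def is_mat3_def intro!: card_mono simp del: box3.simps) simp
  then have "finite (free_weights n P)" by (rule finite_subset) simp
  moreover have "card (ones A) \<in> free_weights n P" using assms by (auto simp: free_weights_def)
  ultimately show ?thesis by (auto simp: ex3_def)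
qed

lemma ex3_leI:
  assumes "\<And>A. is_mat3 A \<Longrightarrow> dims A = (n, n, n) \<Longrightarrow> \<not> contains A P \<Longrightarrow> card (ones A) \<le> k"
  shows "ex3 n P \<le> k"
proof (cases "free_weights n P = {}")
  case False
  have sub: "free_weights n P \<subseteq> {..k}" using assms by (auto simp: free_weights_def)
  then have "finite (free_weights n P)" by (rule finite_subset) simp
  then show ?thesis using False sub by (auto simp: ex3_def)
qed (simp add: ex3_def)

text \<open>By transitivity of containment, a matrix avoiding \<open>Q\<close> also avoids
  \<open>P\<close>.\<close>

lemma ex3_mono:
  assumes "contains P Q" "is_mat3 P" "is_mat3 Q"
  shows "ex3 n Q \<le> ex3 n P"
  using assms by (intro ex3_leI card_le_ex3) (auto simp: is_mat3_def dest: contains_trans)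

section \<open>The two patterns\<close>

abbreviation pick2 :: "nat \<Rightarrow> nat \<Rightarrow> nat \<Rightarrow> nat" where
  "pick2 a b i \<equiv> (if i = 1 then a else b)"

abbreviation pick3 :: "nat \<Rightarrow> nat \<Rightarrow> nat \<Rightarrow> nat \<Rightarrow> nat" where
  "pick3 a b c i \<equiv> (if i = 1 then a else if i = 2 then b else c)"

lemma strict_mono_on_12: "strict_mono_on {1..2::nat} f \<longleftrightarrow> f 1 < (f 2 :: nat)"
proof
  assume "f 1 < f 2"
  moreover have "x = 1 \<and> y = 2" if "x \<in> {1..2}" "y \<in> {1..2}" "x < y" for x y :: nat
    using that by auto
  ultimately show "strict_mono_on {1..2} f" unfolding strict_mono_on_def by metis
qed (simp add: strict_mono_on_def)

text \<open>The index maps of \<open>contains_iff\<close> are replaced by their six values.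
  \<open>Q\<close> is left general to cover the full pattern as well as the patterns with one entry
  removed.\<close>

lemma contains_222_iff:
  assumes "dims A = (n, n, n)" "Q \<subseteq> box3 (2, 2, 2)"
  shows "contains A \<lparr>dims = (2, 2, 2), ones = Q\<rparr> \<longleftrightarrow>
    (\<exists>x1 x2 y1 y2 z1 z2. x1 < x2 \<and> y1 < y2 \<and> z1 < z2 \<and> {x1, x2, y1, y2, z1, z2} \<subseteq> {1..n} \<and>
      (\<forall>(i, j, k) \<in> Q. (pick2 x1 x2 i, pick2 y1 y2 j, pick2 z1 z2 k) \<in> ones A))" (is "?L \<longleftrightarrow> ?R")
proof -
  have 12: "{1..2} = {1, 2::nat}" by auto
  have P: "dims \<lparr>dims = (2, 2, 2), ones = Q\<rparr> = (2, 2, 2)"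
    "ones \<lparr>dims = (2, 2, 2), ones = Q\<rparr> \<subseteq> box3 (dims \<lparr>dims = (2, 2, 2), ones = Q\<rparr>)"
    using assms(2) by simp_all
  note iff = contains_iff[OF assms(1) P, unfolded strict_mono_on_12, unfolded 12]
  show ?thesis
  proof
    assume ?L
    then obtain f g h where fgh: "f 1 < f 2" "g 1 < g 2" "h 1 < h 2"
      "f ` {1, 2} \<subseteq> {1..n}" "g ` {1, 2} \<subseteq> {1..n}" "h ` {1, 2} \<subseteq> {1..n}"
      and Q: "\<forall>(i, j, k) \<in> Q. (f i, g j, h k) \<in> ones A"
      unfolding iff by (elim exE conjE) (rule that, simp_all)
    have "(pick2 (f 1) (f 2) i, pick2 (g 1) (g 2) j, pick2 (h 1) (h 2) k) \<in> ones A"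
      if "(i, j, k) \<in> Q" for i j k
    proof -
      have "i \<in> {1, 2}" "j \<in> {1, 2}" "k \<in> {1, 2}" using that assms(2) unfolding box3.simps 12 by auto
      moreover have "(f i, g j, h k) \<in> ones A" using Q that by auto
      ultimately show ?thesis by auto
    qed
    then have "\<forall>(i, j, k) \<in> Q. (pick2 (f 1) (f 2) i, pick2 (g 1) (g 2) j, pick2 (h 1) (h 2) k) \<in> ones A"
      by blast
    moreover have "{f 1, f 2, g 1, g 2, h 1, h 2} \<subseteq> {1..n}" using fgh(4-6) by simp
    ultimately show ?R using fgh(1-3) by (intro exI conjI)
  next
    assume ?R
    then obtain x1 x2 y1 y2 z1 z2 where less: "x1 < x2" "y1 < y2" "z1 < z2"
      and range: "{x1, x2, y1, y2, z1, z2} \<subseteq> {1..n}"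
      and Q: "\<forall>(i, j, k) \<in> Q. (pick2 x1 x2 i, pick2 y1 y2 j, pick2 z1 z2 k) \<in> ones A"
      by (elim exE conjE) (rule that)
    show ?L
      unfolding iff
    proof (intro exI conjI)
      show "pick2 x1 x2 1 < pick2 x1 x2 2" "pick2 y1 y2 1 < pick2 y1 y2 2" "pick2 z1 z2 1 < pick2 z1 z2 2"
        using less by simp_all
    qed (use range Q in simp_all)
  qed
qed

lemma contains_322I:
  assumes A: "dims A = (n, n, n)" and Q: "Q \<subseteq> box3 (3, 2, 2)"
    and less: "x1 < x2" "x2 < x3" "y1 < y2" "z1 < z2" and range: "{x1, x2, x3, y1, y2, z1, z2} \<subseteq> {1..n}"
    and ones: "\<And>i j k. (i, j, k) \<in> Q \<Longrightarrow> (pick3 x1 x2 x3 i, pick2 y1 y2 j, pick2 z1 z2 k) \<in> ones A"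
  shows "contains A \<lparr>dims = (3, 2, 2), ones = Q\<rparr>"
proof -
  have P: "dims \<lparr>dims = (3, 2, 2), ones = Q\<rparr> = (3, 2, 2)"
    "ones \<lparr>dims = (3, 2, 2), ones = Q\<rparr> \<subseteq> box3 (dims \<lparr>dims = (3, 2, 2), ones = Q\<rparr>)"
    using Q by simp_all
  have 123: "{1..3} = {1, 2, 3::nat}" by auto
  show ?thesis
    unfolding contains_iff[OF A P] strict_mono_on_12
  proof (intro exI conjI)
    show "strict_mono_on {1..3} (pick3 x1 x2 x3)"
      unfolding strict_mono_on_def 123 using less by auto
    show "pick2 y1 y2 1 < pick2 y1 y2 2" "pick2 z1 z2 1 < pick2 z1 z2 2" using less by simp_all
    show "pick3 x1 x2 x3 ` {1..3} \<subseteq> {1..n}" "pick2 y1 y2 ` {1..2} \<subseteq> {1..n}" "pick2 z1 z2 ` {1..2} \<subseteq> {1..n}"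
      using range by auto
    show "\<forall>(x, y, z) \<in> ones \<lparr>dims = (3, 2, 2), ones = Q\<rparr>. (pick3 x1 x2 x3 x, pick2 y1 y2 y, pick2 z1 z2 z) \<in> ones A"
    proof clarify
      fix x y z
      assume "(x, y, z) \<in> ones \<lparr>dims = (3, 2, 2), ones = Q\<rparr>"
      then have "(x, y, z) \<in> Q" by simp
      then show "(pick3 x1 x2 x3 x, pick2 y1 y2 y, pick2 z1 z2 z) \<in> ones A" by (rule ones)
    qed
  qed
qed

section \<open>Deleting extremal 1-entries of lines and diagonals\<close>

text \<open>Of two distinct elements in one fibre of \<open>\<kappa>\<close>, one is excluded by the
  other through \<open>r\<close>; hence \<open>\<kappa>\<close> is injective on the elements
  counted. The fibres will be lines or diagonals, and these elements their last ones.\<close>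

lemma card_extremal_le:
  assumes "finite K" "\<kappa> ` S \<subseteq> K"
    and "\<And>s t. s \<in> S \<Longrightarrow> t \<in> S \<Longrightarrow> \<kappa> s = \<kappa> t \<Longrightarrow> s \<noteq> t \<Longrightarrow> r s t \<or> r t s"
  shows "card {s \<in> S. \<forall>t \<in> S. \<kappa> t = \<kappa> s \<longrightarrow> \<not> r s t} \<le> card K"
proof (rule card_inj_on_le[of \<kappa>])
  show "inj_on \<kappa> {s \<in> S. \<forall>t \<in> S. \<kappa> t = \<kappa> s \<longrightarrow> \<not> r s t}"
    using assms(3) by (intro inj_onI) (force)
qed (use assms in auto)

definition square :: "(nat \<times> nat \<times> nat) set" where
  "square = {(1, 1, 1), (1, 2, 1), (2, 1, 2), (2, 2, 2)}"

text \<open>Carries the 1-entries of the first pattern to those of the second. As a map on positions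
  it also applies after an entry has been removed.\<close>

definition split_layer :: "nat \<times> nat \<times> nat \<Rightarrow> nat \<times> nat \<times> nat" where
  "split_layer = (\<lambda>(x, y, z). (if x = 2 \<and> y = 2 then 3 else x, y, z))"

lemma square_subset_box3: "square \<subseteq> box3 (2, 2, 2)"
  and split_layer_square_subset_box3: "split_layer ` square \<subseteq> box3 (3, 2, 2)"
  by (auto simp: square_def split_layer_def)

text \<open>Deleting the last 1-entry \<open>L\<close> of each line in direction \<open>x\<close>
  costs at most \<open>n^2\<close>. In a copy of \<open>Q\<close> among the remaining entries, the
  one meant for \<open>(3, 2, 2)\<close> can be pushed to a later layer \<open>x3\<close>, as each
  remaining entry has a 1-entry of \<open>A\<close> behind it.\<close>

lemma ex3_split_layer_le:
  assumes Q: "Q \<subseteq> square" "(2, 1, 2) \<in> Q \<or> (2, 2, 2) \<in> Q"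
  shows "ex3 n \<lparr>dims = (3, 2, 2), ones = split_layer ` Q\<rparr> \<le> ex3 n \<lparr>dims = (2, 2, 2), ones = Q\<rparr> + n^2"
proof (rule ex3_leI)
  fix A
  assume A: "is_mat3 A" "dims A = (n, n, n)" and free: "\<not> contains A \<lparr>dims = (3, 2, 2), ones = split_layer ` Q\<rparr>"
  define L where "L = {s \<in> ones A. \<forall>t \<in> ones A. snd t = snd s \<longrightarrow> \<not> fst s < fst t}"
  have box: "ones A \<subseteq> {1..n} \<times> {1..n} \<times> {1..n}" using A by (simp add: is_mat3_def)
  have "card L \<le> card ({1..n} \<times> {1..n})"
    unfolding L_def using box by (intro card_extremal_le) (auto simp: prod_eq_iff)
  then have L: "card L \<le> n^2" by (simp add: power2_eq_square)
  define B where "B = A\<lparr>ones := ones A - L\<rparr>"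
  have B: "is_mat3 B" "dims B = (n, n, n)" using A by (auto simp: B_def is_mat3_def)
  have box2: "Q \<subseteq> box3 (2, 2, 2)" using Q(1) square_subset_box3 by auto
  have box3: "split_layer ` Q \<subseteq> box3 (3, 2, 2)" using Q(1) split_layer_square_subset_box3 by blast
  have "\<not> contains B \<lparr>dims = (2, 2, 2), ones = Q\<rparr>"
  proof
    assume "contains B \<lparr>dims = (2, 2, 2), ones = Q\<rparr>"
    then obtain x1 x2 y1 y2 z1 z2 where less: "x1 < x2" "y1 < y2" "z1 < z2"
      and range: "{x1, x2, y1, y2, z1, z2} \<subseteq> {1..n}"
      and Q_B: "\<forall>(i, j, k) \<in> Q. (pick2 x1 x2 i, pick2 y1 y2 j, pick2 z1 z2 k) \<in> ones B"
      unfolding contains_222_iff[OF B(2) box2] by (elim exE conjE) (rule that)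
    have later: "\<exists>x3 > x2. (x3, y, z) \<in> ones A" if "(x2, y, z) \<in> ones B" for y z
      using that by (auto simp: B_def L_def)
    \<comment> \<open>If \<open>(2, 2, 2)\<close> is missing, the third layer of the pattern is
      empty but still has to be placed; the entry at \<open>(2, 1, 2)\<close> guarantees room behind
      \<open>x2\<close>.\<close>
    have "\<exists>x3 > x2. x3 \<le> n \<and> ((2, 2, 2) \<in> Q \<longrightarrow> (x3, y2, z2) \<in> ones A)"
    proof (cases "(2, 2, 2) \<in> Q")
      case True
      then have "(x2, y2, z2) \<in> ones B" using Q_B by auto
      then show ?thesis using later box by fastforce
    next
      case False
      then have "(x2, y1, z2) \<in> ones B" using Q_B Q(2) by auto
      then show ?thesis using later[of y1 z2] box False by fastforce
    qed
    then obtain x3 where x3: "x2 < x3" "x3 \<le> n" "(2, 2, 2) \<in> Q \<Longrightarrow> (x3, y2, z2) \<in> ones A" by blast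
    have "contains A \<lparr>dims = (3, 2, 2), ones = split_layer ` Q\<rparr>"
    proof (rule contains_322I[OF A(2) box3 less(1) x3(1) less(2,3)])
      show "{x1, x2, x3, y1, y2, z1, z2} \<subseteq> {1..n}" using range x3 by auto
      fix i j k
      assume "(i, j, k) \<in> split_layer ` Q"
      then obtain i' where i': "(i', j, k) \<in> Q" "split_layer (i', j, k) = (i, j, k)"
        by (auto simp: split_layer_def split: if_splits)
      then have "(pick2 x1 x2 i', pick2 y1 y2 j, pick2 z1 z2 k) \<in> ones A" "(i', j, k) \<in> square"
        using Q_B Q(1) by (auto simp: B_def)
      then show "(pick3 x1 x2 x3 i, pick2 y1 y2 j, pick2 z1 z2 k) \<in> ones A"
        using i' x3(3) by (auto simp: square_def split_layer_def)
    qed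
    with free show False ..
  qed
  then have "card (ones A - L) \<le> ex3 n \<lparr>dims = (2, 2, 2), ones = Q\<rparr>"
    using card_le_ex3[OF B] by (simp add: B_def)
  then show "card (ones A) \<le> ex3 n \<lparr>dims = (2, 2, 2), ones = Q\<rparr> + n^2"
    using L diff_card_le_card_Diff[of L "ones A"] finite_subset[OF _ finite_subset[OF box]]
    by (auto simp: L_def)
qed

text \<open>At most \<open>n^2\<close> entries are last on their \<open>y\<close>-line and at most
  \<open>2 * n^2\<close> are last on their diagonal, so some entry is neither. The relations
  \<open>ry\<close> and \<open>rd\<close> select the directions in which "last" is meant.\<close>

lemma exists_pivot:
  fixes ry rd :: "nat \<Rightarrow> nat \<Rightarrow> bool"
  assumes S: "S \<subseteq> {1..n} \<times> {1..n} \<times> {1..n}" "3 * n^2 < card S"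
    and r: "ry \<in> {(<), (>)}" "rd \<in> {(<), (>)}"
  obtains x y z y' x' z' where "(x, y, z) \<in> S" "(x, y', z) \<in> S" "(x', y, z') \<in> S"
    "ry y y'" "rd x x'" "rd z z'"
proof -
  define \<kappa>y where "\<kappa>y = (\<lambda>(x::nat, y::nat, z::nat). (x, z))"
  \<comment> \<open>The shift by \<open>n\<close> keeps natural subtraction exact and codes the
    diagonal \<open>x - z\<close> by a number in \<open>{1..2 * n}\<close>.\<close>
  define \<kappa>d where "\<kappa>d = (\<lambda>(x::nat, y::nat, z::nat). (x + n - z, y))"
  define Ly where "Ly = {s \<in> S. \<forall>t \<in> S. \<kappa>y t = \<kappa>y s \<longrightarrow> \<not> ry (fst (snd s)) (fst (snd t))}"
  define Ld where "Ld = {s \<in> S. \<forall>t \<in> S. \<kappa>d t = \<kappa>d s \<longrightarrow> \<not> rd (fst s) (fst t)}"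
  have "card Ly \<le> card ({1..n} \<times> {1..n})"
    unfolding Ly_def using S(1) r(1) by (intro card_extremal_le) (auto simp: \<kappa>y_def)
  moreover have "card Ld \<le> card ({1..2 * n} \<times> {1..n})"
    unfolding Ld_def using S(1) r(2) by (intro card_extremal_le) (fastforce simp: \<kappa>d_def)+
  moreover have "card (Ly \<union> Ld) \<le> card Ly + card Ld" by (rule card_Un_le)
  ultimately have "card (Ly \<union> Ld) < card S" using S(2) by (simp add: power2_eq_square)
  moreover have "finite (Ly \<union> Ld)"
    using S(1) by (auto simp: Ly_def Ld_def intro: finite_subset)
  ultimately obtain s where s: "s \<in> S" "s \<notin> Ly" "s \<notin> Ld" by (meson UnCI card_mono not_le subsetI)
  obtain x y z where xyz: "s = (x, y, z)" by (cases s)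
  from s(1,2) obtain y' where y': "(x, y', z) \<in> S" "ry y y'"
    unfolding Ly_def xyz by (auto simp: \<kappa>y_def)
  from s(1,3) obtain x' z' where x': "(x', y, z') \<in> S" "rd x x'" "x' + n - z' = x + n - z"
    unfolding Ld_def xyz by (auto simp: \<kappa>d_def)
  have "z \<le> n" "z' \<le> n" using s(1) x'(1) S(1) by (auto simp: xyz)
  \<comment> \<open>On a diagonal, \<open>z\<close> increases exactly when \<open>x\<close>
    does.\<close>
  then have "rd z z'" using x'(2,3) r(2) by auto
  with s(1) y' x' show ?thesis using that by (simp add: xyz)
qed

text \<open>The pivot plays the entry opposite to \<open>e\<close> in the cube, whose
  \<open>y\<close>-neighbour and diagonal neighbour are the other two remaining entries. The
  position of \<open>e\<close> thus dictates the two directions in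
  \<open>exists_pivot\<close>.\<close>

lemma ex3_square_remove_le:
  assumes "e \<in> square"
  shows "ex3 n \<lparr>dims = (2, 2, 2), ones = square - {e}\<rparr> \<le> 3 * n^2"
proof (rule ex3_leI, rule ccontr)
  fix A
  assume A: "is_mat3 A" "dims A = (n, n, n)"
    and free: "\<not> contains A \<lparr>dims = (2, 2, 2), ones = square - {e}\<rparr>"
    and "\<not> card (ones A) \<le> 3 * n^2"
  then have many: "3 * n^2 < card (ones A)" by simp
  have box: "ones A \<subseteq> {1..n} \<times> {1..n} \<times> {1..n}" using A by (simp add: is_mat3_def)
  have "square - {e} \<subseteq> box3 (2, 2, 2)" using square_subset_box3 by auto
  note iff = contains_222_iff[OF A(2) this]
  have I: False if "x1 < x2" "y1 < y2" "z1 < z2" "{x1, x2, y1, y2, z1, z2} \<subseteq> {1..n}"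
    "\<And>i j k. (i, j, k) \<in> square - {e} \<Longrightarrow> (pick2 x1 x2 i, pick2 y1 y2 j, pick2 z1 z2 k) \<in> ones A"
    for x1 x2 y1 y2 z1 z2
  proof -
    have "contains A \<lparr>dims = (2, 2, 2), ones = square - {e}\<rparr>"
      unfolding iff using that by (intro exI conjI) (assumption+, blast)
    with free show False ..
  qed
  consider "e = (1, 1, 1)" | "e = (1, 2, 1)" | "e = (2, 1, 2)" | "e = (2, 2, 2)"
    using assms by (auto simp: square_def)
  then show False
  proof cases
    case 1
    obtain x y z y' x' z' where "(x, y, z) \<in> ones A" "(x, y', z) \<in> ones A" "(x', y, z') \<in> ones A"
      "y > y'" "x > x'" "z > z'" by (rule exists_pivot[OF box many, of "(>)" "(>)"]) auto
    then show False using box by (intro I[of x' x y' y z' z]) (auto simp: 1 square_def)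
  next
    case 2
    obtain x y z y' x' z' where "(x, y, z) \<in> ones A" "(x, y', z) \<in> ones A" "(x', y, z') \<in> ones A"
      "y < y'" "x > x'" "z > z'" by (rule exists_pivot[OF box many, of "(<)" "(>)"]) auto
    then show False using box by (intro I[of x' x y y' z' z]) (auto simp: 2 square_def)
  next
    case 3
    obtain x y z y' x' z' where "(x, y, z) \<in> ones A" "(x, y', z) \<in> ones A" "(x', y, z') \<in> ones A"
      "y > y'" "x < x'" "z < z'" by (rule exists_pivot[OF box many, of "(>)" "(<)"]) auto
    then show False using box by (intro I[of x x' y' y z z']) (auto simp: 3 square_def)
  next
    case 4
    obtain x y z y' x' z' where "(x, y, z) \<in> ones A" "(x, y', z) \<in> ones A" "(x', y, z') \<in> ones A"
      "y < y'" "x < x'" "z < z'" by (rule exists_pivot[OF box many, of "(<)" "(<)"]) auto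
    then show False using box by (intro I[of x x' y y' z z']) (auto simp: 4 square_def)
  qed
qed

section \<open>Upper bound for the full pattern\<close>

text \<open>\<open>T\<close> consists of ordered pairs, equal ones included, so that its size is
  exactly the sum of the squared \<open>y\<close>-line counts. Equal pairs contribute at most
  \<open>n ^ 3\<close>, distinct ones at most \<open>2 * n ^ 3\<close>, with diagonals coded as in
  \<open>exists_pivot\<close>.\<close>

lemma square_free_card_le:
  assumes A: "is_mat3 A" "dims A = (n, n, n)"
    and free: "\<not> contains A \<lparr>dims = (2, 2, 2), ones = square\<rparr>"
  shows "(card (ones A))\<^sup>2 \<le> 3 * n ^ 5"
proof -
  have box: "ones A \<subseteq> {1..n} \<times> {1..n} \<times> {1..n}" using A by (simp add: is_mat3_def)
  have no_square: False if "x1 < x2" "y1 < y2" "z1 < z2"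
    "{(x1, y1, z1), (x1, y2, z1), (x2, y1, z2), (x2, y2, z2)} \<subseteq> ones A" for x1 x2 y1 y2 z1 z2
  proof -
    have "contains A \<lparr>dims = (2, 2, 2), ones = square\<rparr>"
      unfolding contains_222_iff[OF A(2) square_subset_box3]
    proof (intro exI conjI)
      show "{x1, x2, y1, y2, z1, z2} \<subseteq> {1..n}" using that(4) box by auto
      show "\<forall>(i, j, k) \<in> square. (pick2 x1 x2 i, pick2 y1 y2 j, pick2 z1 z2 k) \<in> ones A"
        using that(4) by (auto simp: square_def)
    qed (use that in simp_all)
    with free show False ..
  qed
  define I where "I = {1..n} \<times> {1..n}"
  define D where "D = (\<lambda>(x, z). {y. (x, y, z) \<in> ones A})"
  have D: "D p \<subseteq> {1..n}" for p using box by (auto simp: D_def split: prod.splits)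
  then have fin: "finite (D p)" for p by (rule finite_subset) simp
  have "card (ones A) = card (SIGMA p:I. D p)"
    by (rule bij_betw_same_card[of "\<lambda>(x, y, z). ((x, z), y)"],
        rule bij_betwI[of _ _ _ "\<lambda>((x, z), y). (x, y, z)"]) (use box in \<open>auto simp: D_def I_def\<close>)
  also have "\<dots> = (\<Sum>p\<in>I. card (D p))" by (rule card_SigmaI) (auto simp: I_def fin)
  finally have m: "card (ones A) = (\<Sum>p\<in>I. card (D p))" .
  define T where "T = (SIGMA p:I. D p \<times> D p)"
  have "card T = (\<Sum>p\<in>I. card (D p \<times> D p))"
    unfolding T_def by (rule card_SigmaI) (auto simp: I_def fin)
  then have T: "card T = (\<Sum>p\<in>I. (card (D p))\<^sup>2)" by (simp add: card_cartesian_product power2_eq_square)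
  define T1 where "T1 = {(p, y, y') \<in> T. y = y'}"
  define T2 where "T2 = {(p, y, y') \<in> T. y \<noteq> y'}"
  have "card T1 \<le> card (I \<times> {1..n})"
    by (rule card_inj_on_le[of "\<lambda>(p, y, y'). (p, y)"])
       (use D in \<open>auto simp: T1_def T_def inj_on_def I_def\<close>)
  moreover have "card T2 \<le> card ({1..2 * n} \<times> {1..n} \<times> {1..n})"
  proof (rule card_inj_on_le[of "\<lambda>((x, z), y, y'). (x + n - z, y, y')"])
    show "(\<lambda>((x, z), y, y'). (x + n - z, y, y')) ` T2 \<subseteq> {1..2 * n} \<times> {1..n} \<times> {1..n}"
      using D by (fastforce simp: T2_def T_def I_def)
    show "inj_on (\<lambda>((x, z), y, y'). (x + n - z, y, y')) T2"
    proof (rule inj_onI, clarsimp)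
      fix x z y y' x' z'
      assume in_T2: "((x, z), y, y') \<in> T2" "((x', z'), y, y') \<in> T2" and eq: "x + n - z = x' + n - z'"
      have ones: "(x, y, z) \<in> ones A" "(x, y', z) \<in> ones A" "(x', y, z') \<in> ones A" "(x', y', z') \<in> ones A"
        "y \<noteq> y'" "z \<le> n" "z' \<le> n"
        using in_T2 by (auto simp: T2_def T_def D_def I_def)
      have "\<not> x < x'"
      proof
        assume less: "x < x'"
        then have "z < z'" using eq ones(6,7) by linarith
        \<comment> \<open>The two instances of \<open>no_square\<close> serve the two possible
          orders of \<open>y\<close> and \<open>y'\<close>.\<close>
        then show False
          using less no_square[of x x' y y' z z'] no_square[of x x' y' y z z'] ones
          by (cases y y' rule: linorder_cases) auto
      qed
      moreover have "\<not> x' < x"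
      proof
        assume less: "x' < x"
        then have "z' < z" using eq ones(6,7) by linarith
        then show False
          using less no_square[of x' x y y' z' z] no_square[of x' x y' y z' z] ones
          by (cases y y' rule: linorder_cases) auto
      qed
      ultimately show "x = x' \<and> z = z'" using eq ones by auto
    qed
  qed simp
  moreover have "T = T1 \<union> T2" by (auto simp: T1_def T2_def)
  then have "card T \<le> card T1 + card T2" by (simp add: card_Un_le)
  ultimately have cT: "card T \<le> 3 * n ^ 3"
    by (simp add: I_def power3_eq_cube)
  \<comment> \<open>Cauchy-Schwarz over the \<open>n^2\<close> lines in direction
    \<open>y\<close>.\<close>
  have "(real (card (ones A)))\<^sup>2 \<le> (\<Sum>p\<in>I. (real (card (D p)))\<^sup>2) * card I"
    unfolding m of_nat_sum by (rule sum_squared_le_sum_of_squares)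
  then have "real ((card (ones A))\<^sup>2) \<le> real (card T * card I)" by (simp add: T)
  then have "(card (ones A))\<^sup>2 \<le> card T * n^2"
    unfolding of_nat_le_iff by (simp add: I_def power2_eq_square)
  also have "\<dots> \<le> 3 * n ^ 3 * n ^ 2" using cT by (rule mult_right_mono) simp
  finally show ?thesis by (simp add: mult.assoc flip: power_add)
qed

section \<open>Lower bound from point-line incidences\<close>

text \<open>In \<open>{1..n} \<times> B\<close> membership depends on the last two coordinates only.
  By \<open>cover\<close>, a copy of \<open>P\<close> would therefore project to a proper rectangle
  in \<open>B\<close>.\<close>

lemma powr_le_ex3:
  assumes P: "dims P = (a, 2, 2)" "ones P \<subseteq> box3 (dims P)"
    and cover: "{1, 2} \<times> {1, 2} \<subseteq> snd ` ones P"
  shows "real n powr 2.5 \<le> 8 * real (ex3 n P)"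
proof (cases "n = 0")
  case False
  then obtain B :: "(nat \<times> nat) set"
    where B: "B \<subseteq> {1..n} \<times> {1..n}" "rectangle_free B" "real n powr (3/2) \<le> 8 * real (card B)"
    using rectangle_free_large[of n] by auto
  define A where "A = \<lparr>dims = (n, n, n), ones = {1..n} \<times> B\<rparr>"
  have A: "is_mat3 A" "dims A = (n, n, n)"
    using B(1) False by (auto simp: A_def is_mat3_def)
  have "\<not> contains A P"
  proof
    assume "contains A P"
    then obtain f g h where less: "g 1 < g 2" "h 1 < h 2"
      and ones: "\<forall>(i, j, k) \<in> ones P. (f i, g j, h k) \<in> ones A"
      unfolding contains_iff[OF A(2) P] strict_mono_on_12 by (elim exE conjE) (rule that)
    have "(g j, h k) \<in> B" if "j \<in> {1, 2}" "k \<in> {1, 2}" for j k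
    proof -
      from that cover have "(j, k) \<in> snd ` ones P" by blast
      then obtain i where "(i, j, k) \<in> ones P" by auto
      with ones have "(f i, g j, h k) \<in> ones A" by blast
      then show ?thesis by (simp add: A_def)
    qed
    then have "{(g 1, h 1), (g 2, h 1), (g 1, h 2), (g 2, h 2)} \<subseteq> B" by simp
    then have "g 1 = g 2 \<or> h 1 = h 2" using B(2) unfolding rectangle_free_def by blast
    with less show False by simp
  qed
  from card_le_ex3[OF A this] have le: "n * card B \<le> ex3 n P"
    by (simp add: A_def card_cartesian_product)
  have "real n powr 2.5 = real n * real n powr (3/2)"
    using False by (simp add: powr_mult_base)
  also have "\<dots> \<le> real n * (8 * real (card B))" using B(3) by (rule mult_left_mono) simp
  also have "\<dots> = 8 * real (n * card B)" by simp
  also have "\<dots> \<le> 8 * real (ex3 n P)" using le by (simp only: of_nat_le_iff mult_le_cancel_left_pos zero_less_numeral)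
  finally show ?thesis .
qed simp

lemma ex3_square_le: "real (ex3 n \<lparr>dims = (2, 2, 2), ones = square\<rparr>) \<le> 2 * real n powr 2.5"
proof -
  \<comment> \<open>The floor turns the real bound into a natural number, as \<open>ex3_leI\<close>
    requires.\<close>
  have "ex3 n \<lparr>dims = (2, 2, 2), ones = square\<rparr> \<le> nat \<lfloor>2 * real n powr 2.5\<rfloor>"
  proof (intro ex3_leI le_nat_floor)
    fix A assume A: "is_mat3 A" "dims A = (n, n, n)" "\<not> contains A \<lparr>dims = (2, 2, 2), ones = square\<rparr>"
    then have "n \<ge> 1" by (simp add: is_mat3_def)
    have "real ((card (ones A))\<^sup>2) \<le> real (3 * n ^ 5)"
      using square_free_card_le[OF A] by (simp only: of_nat_le_iff)
    then have "(real (card (ones A)))\<^sup>2 \<le> 3 * real n ^ 5" by simp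
    \<comment> \<open>Rounding 3 up to the square 4 gives the constant 2 after taking roots.\<close>
    also have "\<dots> \<le> 4 * real n powr 5" using \<open>n \<ge> 1\<close> by simp
    also have "\<dots> = (2 * real n powr 2.5)\<^sup>2"
      by (simp add: power_mult_distrib power2_eq_square flip: powr_add)
    finally show "real (card (ones A)) \<le> 2 * real n powr 2.5"
      by (rule power2_le_imp_le) simp
  qed
  then have "real (ex3 n \<lparr>dims = (2, 2, 2), ones = square\<rparr>) \<le> real (nat \<lfloor>2 * real n powr 2.5\<rfloor>)"
    by (simp only: of_nat_le_iff)
  also have "\<dots> \<le> 2 * real n powr 2.5" by (rule of_nat_floor) simp
  finally show ?thesis .
qed

section \<open>Assembling the bounds\<close>

text \<open>Common conclusion for both patterns. The constants are those of the three-layer pattern,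
  which exceed the two-layer ones, 2 and 3, by 1 for the deleted last entries.\<close>

lemma tight_and_minimal:
  assumes P: "is_mat3 P" "dims P = (a, 2, 2)"
    and layers: "fst ` ones P = {1..a}" and cover: "snd ` ones P = {1, 2} \<times> {1, 2}"
    and upper: "\<And>n. real (ex3 n P) \<le> 3 * real n powr 2.5"
    and remove: "\<And>n e. e \<in> ones P \<Longrightarrow> ex3 n (P\<lparr>ones := ones P - {e}\<rparr>) \<le> 4 * n^2"
  shows "(\<lambda>n. real (ex3 n P)) \<in> \<Theta>(\<lambda>n. real n powr 2.5) \<and> minimally_non_O_n2 P"
proof
  have lower: "real n powr 2.5 \<le> 8 * real (ex3 n P)" for n
    using P cover by (intro powr_le_ex3) (auto simp: is_mat3_def)
  have big: "(\<lambda>n. real (ex3 n P)) \<in> \<Omega>(\<lambda>n. real n powr 2.5)"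
    by (rule landau_omega.bigI[of "1/8"]) (use lower in \<open>auto simp: mult.commute intro!: always_eventually\<close>)
  moreover have "(\<lambda>n. real (ex3 n P)) \<in> O(\<lambda>n. real n powr 2.5)"
    by (rule landau_o.bigI[of 3]) (use upper in \<open>auto simp: mult.commute intro!: always_eventually\<close>)
  ultimately show "(\<lambda>n. real (ex3 n P)) \<in> \<Theta>(\<lambda>n. real n powr 2.5)" by (rule bigthetaI[rotated])
  have "(\<lambda>n::nat. real n powr 2.5) \<in> \<omega>(\<lambda>n. real n ^ 2)" by real_asymp
  with big have omega: "(\<lambda>n. real (ex3 n P)) \<in> \<omega>(\<lambda>n. real n ^ 2)"
    by (rule landau_omega.big_small_trans)
  have "(\<lambda>n. real (ex3 n P')) \<in> O(\<lambda>n. real n ^ 2)" if P': "is_mat3 P'" "properly_contained P' P" for P'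
  proof -
    have 12: "{1..2} = {1, 2::nat}" by auto
    have "(fst \<circ> snd) ` ones P = {1..2}" "(snd \<circ> snd) ` ones P = {1..2}"
      unfolding image_comp[symmetric] cover 12 by force+
    then obtain e where e: "e \<in> ones P" "contains (P\<lparr>ones := ones P - {e}\<rparr>) P'"
      using contains_remove_entry[OF P layers _ _ P'] by blast
    have "is_mat3 (P\<lparr>ones := ones P - {e}\<rparr>)" using P by (auto simp: is_mat3_def)
    then have "ex3 n P' \<le> 4 * n^2" for n
      using ex3_mono[OF e(2) _ P'(1)] remove[OF e(1)] order.trans by blast
    then have "real (ex3 n P') \<le> 4 * real n ^ 2" for n
      by (metis of_nat_le_iff of_nat_mult of_nat_numeral of_nat_power)
    then show ?thesis by (intro landau_o.bigI[of 4]) (auto intro!: always_eventually)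
  qed
  with P(1) omega show "minimally_non_O_n2 P" by (auto simp: minimally_non_O_n2_def)
qed

theorem corollary3p17:
  fixes P :: mat3
  assumes "P \<in> {of_layers [[[1, 0], [1, 0]],
                          [[0, 1], [0, 1]]],
                of_layers [[[1, 0], [1, 0]],
                          [[0, 1], [0, 0]],
                          [[0, 0], [0, 1]]]}"
  shows "(\<lambda>n. real (ex3 n P)) \<in> \<Theta>(\<lambda>n. real n powr 2.5) \<and> minimally_non_O_n2 P"
proof -
  have split: "split_layer ` square = {(1, 1, 1), (1, 2, 1), (2, 1, 2), (3, 2, 2)}"
    by (simp add: split_layer_def square_def)
  have inj: "inj_on split_layer square" by (auto simp: inj_on_def split_layer_def square_def)
  have 12: "{1..2} = {1, 2::nat}" and 123: "{1..3} = {1, 2, 3::nat}" by auto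
  from assms consider "P = \<lparr>dims = (2, 2, 2), ones = square\<rparr>"
    | "P = \<lparr>dims = (3, 2, 2), ones = split_layer ` square\<rparr>"
    unfolding of_layers_222 of_layers_322 split unfolding square_def by blast
  then show ?thesis
  proof cases
    case 1
    show ?thesis
    proof (rule tight_and_minimal)
      show "is_mat3 P" using square_subset_box3 by (simp add: 1 is_mat3_def)
      show "fst ` ones P = {1..2}" "snd ` ones P = {1, 2} \<times> {1, 2}"
        unfolding 1 12 by (auto simp: square_def)
      show "real (ex3 n P) \<le> 3 * real n powr 2.5" for n
        unfolding 1 by (rule order.trans[OF ex3_square_le]) simp
      show "ex3 n (P\<lparr>ones := ones P - {e}\<rparr>) \<le> 4 * n^2" if "e \<in> ones P" for n e
        using ex3_square_remove_le[of e n] that by (simp add: 1)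
    qed (simp add: 1)
  next
    case 2
    show ?thesis
    proof (rule tight_and_minimal)
      show "is_mat3 P" using split_layer_square_subset_box3 by (simp add: 2 is_mat3_def)
      show "fst ` ones P = {1..3}" "snd ` ones P = {1, 2} \<times> {1, 2}"
        unfolding 2 123 split by auto
      show "real (ex3 n P) \<le> 3 * real n powr 2.5" for n
      proof -
        have "ex3 n P \<le> ex3 n \<lparr>dims = (2, 2, 2), ones = square\<rparr> + n^2"
          unfolding 2 by (rule ex3_split_layer_le) (auto simp: square_def)
        then have "real (ex3 n P) \<le> real (ex3 n \<lparr>dims = (2, 2, 2), ones = square\<rparr>) + real n ^ 2"
          by (metis of_nat_add of_nat_le_iff of_nat_power)
        moreover have "real n ^ 2 \<le> real n powr 2.5"
        proof (cases "n = 0")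
          case False
          then have "real n powr 2 \<le> real n powr 2.5" by (intro powr_mono) auto
          then show ?thesis using False by simp
        qed simp
        ultimately show ?thesis using ex3_square_le[of n] by linarith
      qed
      show "ex3 n (P\<lparr>ones := ones P - {e}\<rparr>) \<le> 4 * n^2" if "e \<in> ones P" for n e
      proof -
        from that obtain e' where e': "e' \<in> square" "e = split_layer e'" by (auto simp: 2)
        have "split_layer ` square - {e} = split_layer ` (square - {e'})"
          using inj e' by (simp add: inj_on_image_set_diff[of split_layer square])
        then have P_e: "P\<lparr>ones := ones P - {e}\<rparr> = \<lparr>dims = (3, 2, 2), ones = split_layer ` (square - {e'})\<rparr>"
          by (simp add: 2)
        \<comment> \<open>Only one entry was removed, so layer 2 keeps a 1-entry, as
          \<open>ex3_split_layer_le\<close> demands.\<close>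
        have "(2, 1, 2) \<in> square - {e'} \<or> (2, 2, 2) \<in> square - {e'}"
          by (cases "e' = (2, 1, 2)") (simp_all add: square_def)
        then have "ex3 n (P\<lparr>ones := ones P - {e}\<rparr>)
          \<le> ex3 n \<lparr>dims = (2, 2, 2), ones = square - {e'}\<rparr> + n^2"
          unfolding P_e by (intro ex3_split_layer_le) blast
        also have "\<dots> \<le> 4 * n^2" using ex3_square_remove_le[OF e'(1), of n] by simp
        finally show ?thesis .
      qed
    qed (simp add: 2)
  qed
qed

end
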